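(* Let $\beta\in\mathbb{C}$ be an algebraic number of degree $d$. Then for each positive integer $n$ there exist integers $i>j$ such that $\beta^i-\beta^j\in n\mathbb{Z}[\beta]$.
   Context: $\mathbb{Z}[\beta]$ is the subring of $\mathbb{C}$ generated by $\beta$, and $n\mathbb{Z}[\beta]=\{nz : z\in\mathbb{Z}[\beta]\}$. The number $\beta$ is not assumed to be an algebraic integer. *)

theory Defs
  imports
    Complex_Main
    "HOL-Computational_Algebra.Polynomial"
    "HOL-Algebra.Generated_Rings"
    "HOL-Algebra.Algebraic_Closure_Type"
begin

(* The degree of the minimal polynomial over the rationals; only meaningful if x is algebraic.
   The qualified name is needed because HOL-Algebra has a different constant degree. *)
definition alg_degree :: "complex \<Rightarrow> nat" where
  "alg_degree x =
     (LEAST d. \<exists>p :: rat poly. p \<noteq> 0 \<and> poly (map_poly of_rat p) x = 0 \<and> Polynomial.degree p = d)"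

(* The record ring_of_type_algebra is the field of complex numbers with its type-class operations. *)
definition int_adjoin :: "complex \<Rightarrow> complex set" where
  "int_adjoin x = generate_ring ring_of_type_algebra {x}"

definition multiples_int_adjoin :: "nat \<Rightarrow> complex \<Rightarrow> complex set" where
  "multiples_int_adjoin n x = {of_nat n * z | z. z \<in> int_adjoin x}"

end

theory Submission
  imports Defs
begin

text \<open>
  The pigeonhole principle gives the theorem once \<open>\<int>[\<beta>] / n\<int>[\<beta>]\<close> is known to be finite: two of the
  powers of \<open>\<beta>\<close> then lie in the same class. So the content is this finiteness. If \<open>\<beta>\<close> is an
  algebraic integer, it is clear because \<open>\<int>[\<beta>]\<close> is a finitely generated group. For general \<open>\<beta>\<close> the
  group \<open>\<int>[\<beta>]\<close> need not be finitely generated, but it becomes so modulo every prime \<open>p\<close>. Indeed \<open>\<beta>\<close>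
  is a root of an integer polynomial \<open>P\<close> with content 1, so some coefficient of \<open>P\<close> is not divisible
  by \<open>p\<close>. Let \<open>m\<close> be the largest index of such a coefficient. Modulo \<open>p\<close> the terms of \<open>P\<close> above
  \<open>m\<close> vanish and the coefficient at \<open>m\<close> is invertible, so \<open>P\<close> becomes monic of degree \<open>m\<close>
  (\<open>monic_modulo_prime\<close>), and division by a monic polynomial leaves only the finitely many remainders
  of degree below \<open>m\<close> with coefficients reduced modulo \<open>p\<close> (\<open>finite_residues_prime\<close>).

  For composite \<open>n\<close>, finiteness is multiplicative (\<open>finite_residues_mult\<close>), because representatives
  modulo \<open>a\<close> and modulo \<open>b\<close> combine, like digits, to representatives modulo \<open>ab\<close>. The
  detour through primes is there because \<open>P\<close> may have no coefficient that is invertible modulo \<open>n\<close>,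
  as with \<open>2x + 3\<close> modulo 6.
\<close>

section \<open>Evaluation of integer polynomials\<close>

definition int_eval :: "'a::comm_ring_1 \<Rightarrow> int poly \<Rightarrow> 'a" where
  "int_eval x p = poly (map_poly of_int p) x"

lemma int_eval_0 [simp]: "int_eval x 0 = 0"
  by (simp add: int_eval_def)

lemma int_eval_pCons [simp]: "int_eval x (pCons c p) = of_int c + x * int_eval x p"
  by (simp add: int_eval_def map_poly_pCons)

lemma int_eval_1 [simp]: "int_eval x 1 = 1"
  unfolding one_pCons by simp

lemma int_eval_add [simp]: "int_eval x (p + q) = int_eval x p + int_eval x q"
  by (induction p q rule: poly_induct2) (simp_all add: algebra_simps)

lemma int_eval_smult [simp]: "int_eval x (Polynomial.smult c p) = of_int c * int_eval x p"
  by (induction p) (simp_all add: algebra_simps)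

lemma int_eval_minus [simp]: "int_eval x (- p) = - int_eval x p"
  using int_eval_smult[of x "-1" p] by simp

lemma int_eval_diff [simp]: "int_eval x (p - q) = int_eval x p - int_eval x q"
  using int_eval_add[of x p "- q"] by simp

lemma int_eval_mult [simp]: "int_eval x (p * q) = int_eval x p * int_eval x q"
  by (induction p) (simp_all add: algebra_simps)

lemma int_eval_power [simp]: "int_eval x (p ^ k) = int_eval x p ^ k"
  by (induction k) simp_all

lemma power_in_range_int_eval: "x ^ k \<in> range (int_eval x)"
proof
  show "x ^ k = int_eval x ([:0, 1:] ^ k)"
    by simp
qed simp

lemma a_inv_ring_of_type_algebra:
  "\<ominus>\<^bsub>ring_of_type_algebra\<^esub> (z :: 'a::comm_ring_1) = - z"
proof -
  interpret ring "ring_of_type_algebra :: 'a ring"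
    by (rule ring_from_type_algebra)
  show ?thesis
    by (rule minus_equality) (simp_all add: ring_of_type_algebra_def)
qed

lemma of_int_in_generate_ring:
  "of_int k \<in> generate_ring (ring_of_type_algebra :: 'a::comm_ring_1 ring) H"
proof -
  let ?G = "generate_ring (ring_of_type_algebra :: 'a ring) H"
  have one: "1 \<in> ?G"
    using generate_ring.one[of ring_of_type_algebra H] by (simp add: ring_of_type_algebra_def)
  have add: "a + b \<in> ?G" if "a \<in> ?G" "b \<in> ?G" for a b
    using generate_ring.eng_add[OF that] by (simp add: ring_of_type_algebra_def)
  have minus: "- a \<in> ?G" if "a \<in> ?G" for a
    using generate_ring.a_inv[OF that] by (simp add: a_inv_ring_of_type_algebra)
  have zero: "0 \<in> ?G"
    using add[OF one minus[OF one]] by simp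
  have nat: "of_nat j \<in> ?G" for j
    by (induction j) (simp_all add: zero add one)
  show ?thesis
    by (cases k) (simp_all only: of_int_of_nat_eq of_int_minus nat minus)
qed

lemma generate_ring_singleton_eq_range_int_eval:
  "generate_ring (ring_of_type_algebra :: 'a::comm_ring_1 ring) {x} = range (int_eval x)"
proof (intro equalityI subsetI)
  fix z assume "z \<in> generate_ring (ring_of_type_algebra :: 'a ring) {x}"
  then show "z \<in> range (int_eval x)"
  proof (induction rule: generate_ring.induct)
    case one
    show ?case
      using power_in_range_int_eval[of x 0] by (simp add: ring_of_type_algebra_def)
  next
    case (incl h)
    then show ?case
      using power_in_range_int_eval[of x 1] by simp
  next
    case (a_inv h)
    then obtain p where "h = int_eval x p" by blast
    then have "- h = int_eval x (- p)" by simp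
    then show ?case by (simp add: a_inv_ring_of_type_algebra del: int_eval_minus)
  next
    case (eng_add a b)
    then obtain p q where "a = int_eval x p" "b = int_eval x q" by blast
    then have "a + b = int_eval x (p + q)" by simp
    then show ?case by (simp add: ring_of_type_algebra_def del: int_eval_add)
  next
    case (eng_mult a b)
    then obtain p q where "a = int_eval x p" "b = int_eval x q" by blast
    then have "a * b = int_eval x (p * q)" by simp
    then show ?case by (simp add: ring_of_type_algebra_def del: int_eval_mult)
  qed
next
  let ?G = "generate_ring (ring_of_type_algebra :: 'a ring) {x}"
  fix z assume "z \<in> range (int_eval x)"
  then obtain p where z: "z = int_eval x p" by blast
  have add: "a + b \<in> ?G" if "a \<in> ?G" "b \<in> ?G" for a b
    using generate_ring.eng_add[OF that] by (simp add: ring_of_type_algebra_def)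
  have mult: "a * b \<in> ?G" if "a \<in> ?G" "b \<in> ?G" for a b
    using generate_ring.eng_mult[OF that] by (simp add: ring_of_type_algebra_def)
  have x: "x \<in> ?G"
    by (simp add: generate_ring.incl)
  have "int_eval x p \<in> ?G"
  proof (induction p)
    case 0
    show ?case using of_int_in_generate_ring[of 0 "{x}"] by simp
  next
    case (pCons c p)
    then show ?case by (simp add: add mult x of_int_in_generate_ring)
  qed
  then show "z \<in> ?G" by (simp add: z)
qed

section \<open>Finiteness of residues\<close>

text \<open>
  When \<open>R\<close> is a subring, this says that \<open>R / nR\<close> is finite. The representatives \<open>A\<close> may lie outside
  \<open>R\<close>; as they only serve to be counted, this costs nothing and makes the product rule below hold for
  an arbitrary set \<open>R\<close>.
\<close>

definition finite_residues :: "'a::comm_ring_1 set \<Rightarrow> nat \<Rightarrow> bool" where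
  "finite_residues R n \<longleftrightarrow> (\<exists>A. finite A \<and> (\<forall>z\<in>R. \<exists>a\<in>A. \<exists>w\<in>R. z = a + of_nat n * w))"

lemma finite_residues_1: "finite_residues R 1"
  unfolding finite_residues_def by (rule exI[of _ "{0}"]) auto

text \<open>
  Writing \<open>z = a + m w\<close> and then \<open>w = b + n w'\<close> gives \<open>z = (a + m b) + m n w'\<close>, a two-digit expansion.
\<close>

lemma finite_residues_mult:
  assumes "finite_residues R m" and "finite_residues R n"
  shows "finite_residues R (m * n)"
proof -
  obtain A where A: "finite A" "\<forall>z\<in>R. \<exists>a\<in>A. \<exists>w\<in>R. z = a + of_nat m * w"
    using assms(1) unfolding finite_residues_def by blast
  obtain B where B: "finite B" "\<forall>z\<in>R. \<exists>b\<in>B. \<exists>w\<in>R. z = b + of_nat n * w"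
    using assms(2) unfolding finite_residues_def by blast
  let ?C = "(\<lambda>(a, b). a + of_nat m * b) ` (A \<times> B)"
  have "\<exists>c\<in>?C. \<exists>w\<in>R. z = c + of_nat (m * n) * w" if z: "z \<in> R" for z
  proof -
    obtain a w where a: "a \<in> A" "w \<in> R" "z = a + of_nat m * w"
      using A(2) z by blast
    obtain b v where b: "b \<in> B" "v \<in> R" "w = b + of_nat n * v"
      using B(2) a(2) by blast
    have "z = (a + of_nat m * b) + of_nat (m * n) * v"
      using a(3) b(3) by (simp add: algebra_simps)
    then show ?thesis
      using a(1) b(1,2) by force
  qed
  moreover have "finite ?C"
    using A(1) B(1) by simp
  ultimately show ?thesis
    unfolding finite_residues_def by blast
qed

lemma finite_residues_of_primes:
  assumes "\<And>p. Factorial_Ring.prime p \<Longrightarrow> finite_residues R p" and "n > 0"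
  shows "finite_residues R n"
  using assms(2)
proof (induction n rule: prime_divisors_induct)
  case (unit n)
  then show ?case using finite_residues_1[of R] by simp
next
  case (factor p n)
  then show ?case by (simp add: assms(1) finite_residues_mult)
qed simp

text \<open>
  If \<open>m\<close> is the largest index with \<open>p\<close> not dividing the coefficient \<open>a\<^sub>m\<close> of \<open>P\<close>, and \<open>u a\<^sub>m + v p = 1\<close>,
  then \<open>u P\<close> agrees with a monic polynomial of degree \<open>m\<close> modulo \<open>p\<close>: the multiple \<open>p W\<close> removes the
  terms above \<open>m\<close> and corrects the coefficient at \<open>m\<close> to 1.
\<close>

lemma monic_modulo_prime:
  fixes p :: int and P :: "int poly"
  assumes "Factorial_Ring.prime p" and "\<not> p dvd Polynomial.content P"
  obtains u W where "lead_coeff (Polynomial.smult u P + Polynomial.smult p W) = 1"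
proof -
  let ?S = "{i. \<not> p dvd Polynomial.coeff P i}"
  have "\<not> [:p:] dvd P"
    using assms(2) by (simp add: const_poly_dvd_iff_dvd_content)
  then have ne: "?S \<noteq> {}"
    by (auto simp: const_poly_dvd_iff)
  have "?S \<subseteq> {..Polynomial.degree P}"
    by (auto intro: le_degree)
  then have fin: "finite ?S"
    by (rule finite_subset) simp
  define m where "m = Max ?S"
  have m: "\<not> p dvd Polynomial.coeff P m"
    using Max_in[OF fin ne] by (simp add: m_def)
  have above: "p dvd Polynomial.coeff P i" if "i > m" for i
    using Max_ge[OF fin, of i] that by (auto simp: m_def)
  have "coprime p (Polynomial.coeff P m)"
    using assms(1) m by (rule prime_imp_coprime)
  then obtain v u where uv: "v * p + u * Polynomial.coeff P m = 1"
    using bezout_int[of p "Polynomial.coeff P m"] by auto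
  have "[:p:] dvd P - poly_cutoff (Suc m) P"
    using above by (auto simp: const_poly_dvd_iff coeff_poly_cutoff)
  then obtain t where "P - poly_cutoff (Suc m) P = [:p:] * t"
    by (rule dvdE)
  then have t: "P - poly_cutoff (Suc m) P = Polynomial.smult p t"
    by simp
  define W where "W = Polynomial.monom v m - Polynomial.smult u t"
  define U where "U = Polynomial.smult u P + Polynomial.smult p W"
  have "U = Polynomial.smult u (poly_cutoff (Suc m) P) + Polynomial.monom (p * v) m"
  proof -
    have "U = Polynomial.smult u (P - Polynomial.smult p t) + Polynomial.smult p (Polynomial.monom v m)"
      by (simp add: U_def W_def smult_diff_right mult.commute)
    then show ?thesis
      by (simp add: t[symmetric] smult_monom)
  qed
  then have coeff: "Polynomial.coeff U i =
      (if i < Suc m then u * Polynomial.coeff P i else 0) + (if i = m then p * v else 0)" for i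
    by (auto simp: coeff_poly_cutoff)
  have "Polynomial.degree U \<le> m"
    by (rule degree_le) (simp add: coeff)
  moreover have "Polynomial.coeff U m = 1"
    using uv by (simp add: coeff algebra_simps)
  ultimately have "lead_coeff U = 1"
    by (metis le_antisym le_degree zero_neq_one)
  then show thesis
    using that by (simp add: U_def)
qed

lemma finite_bounded_int_polys:
  "finite {r :: int poly. Polynomial.degree r \<le> m \<and> (\<forall>i. Polynomial.coeff r i \<in> {0..<p})}"
  (is "finite ?F")
proof -
  let ?L = "{xs :: int list. set xs \<subseteq> {0..<p} \<and> length xs \<le> Suc m}"
  have "?F \<subseteq> Poly ` ?L"
  proof
    fix r assume r: "r \<in> ?F"
    then have "set (coeffs r) \<subseteq> {0..<p}"
      by (auto simp: coeffs_def simp del: upt_Suc)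
    moreover have "length (coeffs r) \<le> Suc m"
      using r by (cases "r = 0") (simp_all add: length_coeffs)
    ultimately have "coeffs r \<in> ?L" by blast
    then show "r \<in> Poly ` ?L"
      by (intro image_eqI[of _ _ "coeffs r"]) simp_all
  qed
  moreover have "finite ?L"
    by (rule finite_lists_length_le) simp
  ultimately show ?thesis
    by (rule finite_surj[rotated])
qed

text \<open>
  The root \<open>x\<close> of \<open>P\<close> makes the monic polynomial \<open>U = u P + p W\<close> take the value \<open>p W(x)\<close> at \<open>x\<close>, so
  dividing \<open>f\<close> by \<open>U\<close> does not change \<open>f(x)\<close> modulo \<open>p\<close>.
\<close>

lemma finite_residues_prime:
  fixes x :: "'a::comm_ring_1" and p :: nat
  assumes "Factorial_Ring.prime p" and "Polynomial.content P = 1" and "int_eval x P = 0"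
  shows "finite_residues (range (int_eval x)) p"
proof -
  have p: "Factorial_Ring.prime (int p)" "int p > 0"
    using assms(1) by (simp_all add: prime_gt_0_nat)
  have "\<not> int p dvd Polynomial.content P"
    using prime_gt_1_nat[OF assms(1)] assms(2) by simp
  then obtain u W where "lead_coeff (Polynomial.smult u P + Polynomial.smult (int p) W) = 1"
    using p(1) monic_modulo_prime by blast
  moreover define U where "U = Polynomial.smult u P + Polynomial.smult (int p) W"
  ultimately have monic: "lead_coeff U = 1" by simp
  have U_x: "int_eval x U = of_nat p * int_eval x W"
    by (simp add: U_def assms(3))
  let ?F = "{r :: int poly. Polynomial.degree r \<le> Polynomial.degree U
    \<and> (\<forall>i. Polynomial.coeff r i \<in> {0..<int p})}"
  have "\<exists>a\<in>int_eval x ` ?F. \<exists>w\<in>range (int_eval x). int_eval x f = a + of_nat p * w" for f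
  proof -
    obtain q r where qr: "pseudo_divmod f U = (q, r)"
      by fastforce
    have "U \<noteq> 0"
      using monic by auto
    then have f: "f = U * q + r" and deg: "Polynomial.degree r \<le> Polynomial.degree U"
      using pseudo_divmod[OF _ qr] monic by auto
    define r0 where "r0 = map_poly (\<lambda>c. c mod int p) r"
    define r1 where "r1 = map_poly (\<lambda>c. c div int p) r"
    have r: "r = r0 + Polynomial.smult (int p) r1"
      by (rule poly_eqI) (simp add: r0_def r1_def coeff_map_poly)
    have "Polynomial.degree r0 \<le> Polynomial.degree U"
      using deg by (intro degree_le) (simp add: r0_def coeff_map_poly coeff_eq_0)
    then have "r0 \<in> ?F"
      using p(2) by (simp add: r0_def coeff_map_poly)
    moreover have "int_eval x f = int_eval x r0 + of_nat p * int_eval x (W * q + r1)"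
      by (subst f, subst r) (simp add: U_x algebra_simps)
    ultimately show ?thesis by blast
  qed
  then show ?thesis
    unfolding finite_residues_def using finite_bounded_int_polys by blast
qed

lemma algebraic_root_of_primitive_poly:
  fixes x :: "'a::field_char_0"
  assumes "algebraic x"
  obtains P where "Polynomial.content P = 1" and "int_eval x P = 0"
proof -
  obtain Q where Q: "Q \<noteq> 0" "poly (map_poly of_int Q) x = 0"
    using assms by (rule algebraicE')
  let ?P = "primitive_part Q"
  have "of_int (Polynomial.content Q) * int_eval x ?P = int_eval x Q"
    by (simp flip: int_eval_smult)
  then have "int_eval x ?P = 0"
    using Q by (simp add: int_eval_def)
  moreover have "Polynomial.content ?P = 1"
    using Q(1) by simp
  ultimately show thesis using that by blast
qed

section \<open>Congruent powers\<close>

theorem theorem3p4: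
  fixes \<beta> :: complex and d :: nat
  assumes "algebraic \<beta>" and "alg_degree \<beta> = d"
  shows "\<forall>n :: nat. n > 0 \<longrightarrow>
    (\<exists>i j :: nat. i > j \<and> \<beta> ^ i - \<beta> ^ j \<in> multiples_int_adjoin n \<beta>)"
proof (intro allI impI)
  fix n :: nat
  assume n: "n > 0"
  let ?R = "range (int_eval \<beta>)"
  obtain P where "Polynomial.content P = 1" "int_eval \<beta> P = 0"
    using assms(1) by (rule algebraic_root_of_primitive_poly)
  then have "finite_residues ?R n"
    using finite_residues_prime finite_residues_of_primes n by blast
  then obtain A where A: "finite A" "\<forall>z\<in>?R. \<exists>a\<in>A. \<exists>w\<in>?R. z = a + of_nat n * w"
    unfolding finite_residues_def by blast
  have "\<forall>k. \<exists>a w. a \<in> A \<and> w \<in> ?R \<and> \<beta> ^ k = a + of_nat n * w"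
    using A(2) power_in_range_int_eval[of \<beta>] by blast
  then obtain a w where aw: "\<And>k. a k \<in> A" "\<And>k. w k \<in> ?R" "\<And>k. \<beta> ^ k = a k + of_nat n * w k"
    by metis
  have "finite (range a)"
    using A(1) aw(1) by (meson finite_subset image_subsetI)
  then have "\<not> inj a"
    using finite_imageD infinite_UNIV_nat by blast
  then obtain i j where ij: "i > j" "a i = a j"
    unfolding inj_def by (metis linorder_neqE_nat)
  have "\<beta> ^ i - \<beta> ^ j = of_nat n * (w i - w j)"
    using aw(3)[of i] aw(3)[of j] ij(2) by (simp add: algebra_simps)
  moreover have "w i - w j \<in> int_adjoin \<beta>"
  proof -
    obtain p q where "w i = int_eval \<beta> p" "w j = int_eval \<beta> q"
      using aw(2) by blast
    then have "w i - w j = int_eval \<beta> (p - q)" by simp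
    then show ?thesis
      unfolding int_adjoin_def generate_ring_singleton_eq_range_int_eval by blast
  qed
  ultimately show "\<exists>i j. i > j \<and> \<beta> ^ i - \<beta> ^ j \<in> multiples_int_adjoin n \<beta>"
    using ij(1) unfolding multiples_int_adjoin_def by blast
qed

end
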